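(* Let $\mathbb F$ be a finite field, $G$ a finite-dimensional linear space over $\mathbb F$, $S\subset G^*\oplus G$ an isotropic linear subspace, and $\zeta$ a character of the abelian algebra $\mathfrak A(G|S)$. Then the stabilizer code $\mathbf v_{(\zeta,S)}$ is equivalent to a graph code. That is, there exist finite-dimensional linear spaces $H,F$ over $\mathbb F$, a symmetric linear operator $$\Gamma=\begin{pmatrix} 0 & 0 & B^* \\ 0 & 0 & C^* \\ B & C & A \end{pmatrix}:H\oplus F\oplus G\to H^*\oplus F^*\oplus G^*$$ with $A:G\to G^*$, $B:H\to G^*$ injective and $C:F\to G^*$, and a character $\tilde\tau$ of $\mathfrak A(H\oplus F\oplus G|S_\Gamma)$, such that $\mathbf v_{(\zeta,S)}$ is equivalent to the graph code $\mathbf v_{(\tau,\Gamma)}$.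
   Context: Fix a finite field $\mathbb F$; all linear spaces over $\mathbb F$ are finite-dimensional. $G^*$ is the dual space and $\langle\hat g,g\rangle\in\mathbb F$ the dual pairing. Fix a group isomorphism $\chi:\mathbb F\to\mathbb F^\wedge$ (additive group to its character group) with $\chi(a)(a')=\chi(a')(a)$; put $\varepsilon=\chi(1)$ and $\chi(\hat g|g):=\varepsilon(\langle\hat g,g\rangle)$. $L_2(G)$ is the space of all complex functions on $G$ with $\langle\psi,\psi'\rangle=\int dg\,\overline{\psi(g)}\psi'(g)$, where $\int dg$ is the normalized Haar measure (sum over $G$ divided by $|G|$). Weyl operators on $L_2(G)$: $(\mathbf w(\hat g,g)\psi)(g_1)=\chi(\hat g|g_1)\,\psi(g_1-g)$ for $(\hat g,g)\in G^*\oplus G$. A linear subspace $S\subset G^*\oplus G$ is isotropic if $\langle\hat g_0,g_1\rangle-\langle\hat g_1,g_0\rangle=0$ for all $(\hat g_0,g_0),(\hat g_1,g_1)\in S$. $\mathfrak A(G|S)$ is the complex algebra generated by the $\mathbf w(\hat g,g)$ with $(\hat g,g)\in S$; it is abelian for isotropic $S$. A character is a unital algebra homomorphism to $\mathbb C$. Stabilizer code associated with $(\zeta,S)$: the isometric embedding $\mathbf v_{(\zeta,S)}$ of $\mathcal H(\zeta)=\{\psi\in L_2(G): a\psi=\zeta(a)\psi\ \forall a\in\mathfrak A(G|S)\}$ into $L_2(G)$. Symmetric operator: a linear map $\Gamma:V\to V^*$ with $\Gamma^*=\Gamma$ (identifying $V^{**}=V$). For such $\Gamma$ on $V=H\oplus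 F\oplus G$, of the displayed block form with $B$ injective, put $S_\Gamma=\{(\Gamma v,v)\mid v\in V\}$, an isotropic subspace of $V^*\oplus V$. Given a character $\tilde\tau$ of $\mathfrak A(V|S_\Gamma)$, set $\tau(v)=\tilde\tau(\mathbf w(\Gamma v,v))$. The graph code associated with $(\tau,\Gamma)$ is the linear map $\mathbf v_{(\tau,\Gamma)}:L_2(H)\to L_2(G)$, $$(\mathbf v_{(\tau,\Gamma)}\psi)(g)=\sqrt{|H||F|}\int dh\,df\ \tau(h\oplus f\oplus g)\,\psi(h),$$ with normalized Haar measures. The protected subspace of a code is its image in $L_2(G)$. Two codes with values in $L_2(G)$ are equivalent if some Weyl operator $\mathbf w(\hat g,g)$, $(\hat g,g)\in G^*\oplus G$, maps the protected subspace of one onto that of the other. *)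

theory Defs
  imports "HOL-Analysis.Analysis" "HOL-Library.Function_Algebras"
begin

section \<open>Finite-dimensional linear spaces as carriers\<close>

text \<open>
  A linear space over the finite field \<open>'f\<close> is a subspace \<open>V\<close> of some vector space with scalar
  multiplication \<open>s\<close>. Functions on \<open>V\<close> (functionals, wave functions) are represented by
  functions on the ambient type that vanish outside \<open>V\<close>, so that equality of functions on \<open>V\<close> is
  equality in HOL and sums are pointwise.
\<close>

definition fin_dim_space :: "('f::field \<Rightarrow> 'v::ab_group_add \<Rightarrow> 'v) \<Rightarrow> 'v set \<Rightarrow> bool" where
  "fin_dim_space s V \<longleftrightarrow> vector_space s \<and> module.subspace s V \<and>
     (\<exists>B. finite B \<and> module.span s B = V)"

definition linear_on :: "('f \<Rightarrow> 'v::plus \<Rightarrow> 'v) \<Rightarrow> ('f \<Rightarrow> 'w::plus \<Rightarrow> 'w) \<Rightarrow>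
    'v set \<Rightarrow> 'w set \<Rightarrow> ('v \<Rightarrow> 'w) \<Rightarrow> bool" where
  "linear_on s t V W T \<longleftrightarrow> T ` V \<subseteq> W \<and>
     (\<forall>x\<in>V. \<forall>y\<in>V. T (x + y) = T x + T y) \<and> (\<forall>c. \<forall>x\<in>V. T (s c x) = t c (T x))"

definition fun_scale :: "'f::times \<Rightarrow> ('x \<Rightarrow> 'f) \<Rightarrow> 'x \<Rightarrow> 'f" where
  "fun_scale c \<phi> = (\<lambda>x. c * \<phi> x)"

definition dual :: "('f::field \<Rightarrow> 'v::ab_group_add \<Rightarrow> 'v) \<Rightarrow> 'v set \<Rightarrow> ('v \<Rightarrow> 'f) set" where
  "dual s V = {\<phi>. linear_on s (*) V UNIV \<phi> \<and> (\<forall>x. x \<notin> V \<longrightarrow> \<phi> x = 0)}"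

text \<open>
  The adjoint of \<open>T : V \<rightarrow> W\<^sup>*\<close>, with \<open>W\<^sup>*\<^sup>*\<close> identified with \<open>W\<close>, is the map \<open>W \<rightarrow> V\<^sup>*\<close> below.
\<close>

definition adjoint_on :: "'v set \<Rightarrow> ('v \<Rightarrow> 'w \<Rightarrow> 'f::zero) \<Rightarrow> 'w \<Rightarrow> 'v \<Rightarrow> 'f" where
  "adjoint_on V T w = (\<lambda>v. if v \<in> V then T v w else 0)"

definition symmetric_operator :: "('f::field \<Rightarrow> 'v::ab_group_add \<Rightarrow> 'v) \<Rightarrow> 'v set \<Rightarrow>
    ('v \<Rightarrow> 'v \<Rightarrow> 'f) \<Rightarrow> bool" where
  "symmetric_operator s V \<Gamma> \<longleftrightarrow>
     linear_on s fun_scale V (dual s V) \<Gamma> \<and> (\<forall>v\<in>V. adjoint_on V \<Gamma> v = \<Gamma> v)"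

definition isotropic :: "('f::field \<Rightarrow> 'v::ab_group_add \<Rightarrow> 'v) \<Rightarrow> 'v set \<Rightarrow>
    (('v \<Rightarrow> 'f) \<times> 'v) set \<Rightarrow> bool" where
  "isotropic s V S \<longleftrightarrow> S \<subseteq> dual s V \<times> V \<and>
     module.subspace (module_prod.scale fun_scale s) S \<and>
     (\<forall>(\<phi>0, x0) \<in> S. \<forall>(\<phi>1, x1) \<in> S. \<phi>0 x1 - \<phi>1 x0 = 0)"


section \<open>Weyl operators\<close>

definition additive_characters :: "('f::ab_group_add \<Rightarrow> complex) set" where
  "additive_characters = {c. (\<forall>a b. c (a + b) = c a * c b) \<and> (\<forall>a. cmod (c a) = 1)}"

definition symmetric_self_duality :: "('f::ab_group_add \<Rightarrow> 'f \<Rightarrow> complex) \<Rightarrow> bool" where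
  "symmetric_self_duality chi \<longleftrightarrow>
     bij_betw chi UNIV additive_characters \<and>
     (\<forall>a b. chi (a + b) = (\<lambda>c. chi a c * chi b c)) \<and>
     (\<forall>a b. chi a b = chi b a)"

definition L2 :: "'v set \<Rightarrow> ('v \<Rightarrow> complex) set" where
  "L2 V = {\<psi>. \<forall>x. x \<notin> V \<longrightarrow> \<psi> x = 0}"

text \<open>
  An operator on \<open>L2 V\<close> is represented by a map on all functions on the ambient type which first
  discards the values of its argument outside \<open>V\<close> and has values in \<open>L2 V\<close>. This representation
  is one-to-one and turns products of operators into plain composition; the unit is \<open>L2_id V\<close>.
\<close>

type_synonym 'v L2_op = "('v \<Rightarrow> complex) \<Rightarrow> 'v \<Rightarrow> complex"

definition L2_id :: "'v set \<Rightarrow> 'v L2_op" where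
  "L2_id V = (\<lambda>\<psi> x. if x \<in> V then \<psi> x else 0)"

definition weyl :: "('f::field \<Rightarrow> 'f \<Rightarrow> complex) \<Rightarrow> 'v::ab_group_add set \<Rightarrow>
    ('v \<Rightarrow> 'f) \<times> 'v \<Rightarrow> 'v L2_op" where
  "weyl chi V = (\<lambda>(\<phi>, g) \<psi> x. if x \<in> V then chi 1 (\<phi> x) * \<psi> (x - g) else 0)"

inductive_set weyl_algebra :: "('f::field \<Rightarrow> 'f \<Rightarrow> complex) \<Rightarrow> 'v::ab_group_add set \<Rightarrow>
    (('v \<Rightarrow> 'f) \<times> 'v) set \<Rightarrow> 'v L2_op set"
  for chi :: "'f::field \<Rightarrow> 'f \<Rightarrow> complex" and V :: "'v::ab_group_add set"
    and S :: "(('v \<Rightarrow> 'f) \<times> 'v) set" where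
  unit: "L2_id V \<in> weyl_algebra chi V S"
| gen: "p \<in> S \<Longrightarrow> weyl chi V p \<in> weyl_algebra chi V S"
| add: "a \<in> weyl_algebra chi V S \<Longrightarrow> b \<in> weyl_algebra chi V S \<Longrightarrow>
    (\<lambda>\<psi> x. a \<psi> x + b \<psi> x) \<in> weyl_algebra chi V S"
| scale: "a \<in> weyl_algebra chi V S \<Longrightarrow> (\<lambda>\<psi> x. c * a \<psi> x) \<in> weyl_algebra chi V S"
| mult: "a \<in> weyl_algebra chi V S \<Longrightarrow> b \<in> weyl_algebra chi V S \<Longrightarrow> a \<circ> b \<in> weyl_algebra chi V S"

definition algebra_character :: "'v set \<Rightarrow> 'v L2_op set \<Rightarrow> ('v L2_op \<Rightarrow> complex) \<Rightarrow> bool" where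
  "algebra_character V \<AA> \<zeta> \<longleftrightarrow> \<zeta> (L2_id V) = 1 \<and>
     (\<forall>a\<in>\<AA>. \<forall>b\<in>\<AA>. \<zeta> (\<lambda>\<psi> x. a \<psi> x + b \<psi> x) = \<zeta> a + \<zeta> b \<and> \<zeta> (a \<circ> b) = \<zeta> a * \<zeta> b) \<and>
     (\<forall>c. \<forall>a\<in>\<AA>. \<zeta> (\<lambda>\<psi> x. c * a \<psi> x) = c * \<zeta> a)"


section \<open>Codes\<close>

text \<open>A code is a linear map, given together with the input space on which it is defined.\<close>

type_synonym ('d, 'g) code = "('d \<Rightarrow> complex) set \<times> (('d \<Rightarrow> complex) \<Rightarrow> ('g \<Rightarrow> complex))"

definition protected_subspace :: "('d, 'g) code \<Rightarrow> ('g \<Rightarrow> complex) set" where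
  "protected_subspace v = snd v ` fst v"

definition equivalent_codes :: "('f::field \<Rightarrow> 'f \<Rightarrow> complex) \<Rightarrow>
    ('f \<Rightarrow> 'g::ab_group_add \<Rightarrow> 'g) \<Rightarrow> 'g set \<Rightarrow> ('d, 'g) code \<Rightarrow> ('e, 'g) code \<Rightarrow> bool" where
  "equivalent_codes chi s G v w \<longleftrightarrow>
     (\<exists>p \<in> dual s G \<times> G. weyl chi G p ` protected_subspace v = protected_subspace w)"

definition stabilizer_space :: "('f::field \<Rightarrow> 'f \<Rightarrow> complex) \<Rightarrow> 'g::ab_group_add set \<Rightarrow>
    ('g L2_op \<Rightarrow> complex) \<Rightarrow> (('g \<Rightarrow> 'f) \<times> 'g) set \<Rightarrow> ('g \<Rightarrow> complex) set" where
  "stabilizer_space chi G \<zeta> S =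
     {\<psi> \<in> L2 G. \<forall>a \<in> weyl_algebra chi G S. a \<psi> = (\<lambda>x. \<zeta> a * \<psi> x)}"

definition stabilizer_code :: "('f::field \<Rightarrow> 'f \<Rightarrow> complex) \<Rightarrow> 'g::ab_group_add set \<Rightarrow>
    ('g L2_op \<Rightarrow> complex) \<Rightarrow> (('g \<Rightarrow> 'f) \<times> 'g) set \<Rightarrow> ('g, 'g) code" where
  "stabilizer_code chi G \<zeta> S = (stabilizer_space chi G \<zeta> S, \<lambda>\<psi>. \<psi>)"

definition haar_integral :: "'v set \<Rightarrow> ('v \<Rightarrow> complex) \<Rightarrow> complex" where
  "haar_integral V u = (\<Sum>x\<in>V. u x) / of_nat (card V)"

definition graph_code :: "'h set \<Rightarrow> 'k set \<Rightarrow> 'g set \<Rightarrow> ('h \<times> 'k \<times> 'g \<Rightarrow> complex) \<Rightarrow>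
    ('h, 'g) code" where
  "graph_code H F G \<tau> = (L2 H, \<lambda>\<psi> g. if g \<in> G
     then complex_of_real (sqrt (real (card H) * real (card F))) *
       haar_integral H (\<lambda>h. haar_integral F (\<lambda>f. \<tau> (h, f, g) * \<psi> h))
     else 0)"

definition sum3_scale :: "('f::field \<Rightarrow> 'h::ab_group_add \<Rightarrow> 'h) \<Rightarrow>
    ('f \<Rightarrow> 'k::ab_group_add \<Rightarrow> 'k) \<Rightarrow> ('f \<Rightarrow> 'g::ab_group_add \<Rightarrow> 'g) \<Rightarrow>
    'f \<Rightarrow> 'h \<times> 'k \<times> 'g \<Rightarrow> 'h \<times> 'k \<times> 'g" where
  "sum3_scale sH sF sG = module_prod.scale sH (module_prod.scale sF sG)"

text \<open>The identification of \<open>H\<^sup>* \<oplus> F\<^sup>* \<oplus> G\<^sup>*\<close> with \<open>(H \<oplus> F \<oplus> G)\<^sup>*\<close>.\<close>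

definition dual_sum3 :: "'h set \<Rightarrow> 'k set \<Rightarrow> 'g set \<Rightarrow>
    ('h \<Rightarrow> 'f::field) \<times> ('k \<Rightarrow> 'f) \<times> ('g \<Rightarrow> 'f) \<Rightarrow> 'h \<times> 'k \<times> 'g \<Rightarrow> 'f" where
  "dual_sum3 H F G = (\<lambda>(\<alpha>, \<beta>, \<gamma>) (h, f, g).
     if h \<in> H \<and> f \<in> F \<and> g \<in> G then \<alpha> h + \<beta> f + \<gamma> g else 0)"

definition graph_operator :: "'h set \<Rightarrow> 'k set \<Rightarrow> 'g set \<Rightarrow> ('g \<Rightarrow> 'g \<Rightarrow> 'f::field) \<Rightarrow>
    ('h \<Rightarrow> 'g \<Rightarrow> 'f) \<Rightarrow> ('k \<Rightarrow> 'g \<Rightarrow> 'f) \<Rightarrow> 'h \<times> 'k \<times> 'g \<Rightarrow> 'h \<times> 'k \<times> 'g \<Rightarrow> 'f" where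
  "graph_operator H F G A B C = (\<lambda>(h, f, g).
     dual_sum3 H F G (adjoint_on H B g, adjoint_on F C g, B h + C f + A g))"

definition graph_subspace :: "'v set \<Rightarrow> ('v \<Rightarrow> 'v \<Rightarrow> 'f) \<Rightarrow> (('v \<Rightarrow> 'f) \<times> 'v) set" where
  "graph_subspace V \<Gamma> = {(\<Gamma> v, v) | v. v \<in> V}"

definition graph_phase :: "('f::field \<Rightarrow> 'f \<Rightarrow> complex) \<Rightarrow> 'v::ab_group_add set \<Rightarrow>
    ('v \<Rightarrow> 'v \<Rightarrow> 'f) \<Rightarrow> ('v L2_op \<Rightarrow> complex) \<Rightarrow> 'v \<Rightarrow> complex" where
  "graph_phase chi V \<Gamma> \<tau>' v = \<tau>' (weyl chi V (\<Gamma> v, v))"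

end

(*
  Write eps = chi 1, P for the projection of S to G and K = {k. (k, 0) in S}. A vector of the
  stabilizer space is supported on D = {x. zeta (w (k, 0)) = eps (k x) for all k in K} and changes
  under translations by P by prescribed phases. So, for a quadratic phase gamma on G with these
  phases, the stabilizer space consists of the functions gamma * 1_D * u with u invariant under P.
  A graph code with phase
    tau (h, f, g) = zeta (w (- C f, 0)) * eps (B h g + C f g) * gamma g
  has the same image if C has range K, because the integral over F is then the indicator of D, and
  B has range the annihilator of P, because the integral over H is then the Fourier expansion of
  an arbitrary P-invariant function. The Weyl operator in the equivalence is the identity.
*)

theory Submission
  imports Defs
begin

section \<open>Linear algebra\<close>

lemma vector_space_fun_scale: "vector_space (fun_scale :: 'f::field \<Rightarrow> ('x \<Rightarrow> 'f) \<Rightarrow> 'x \<Rightarrow> 'f)"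
  by unfold_locales (auto simp: fun_scale_def fun_eq_iff algebra_simps)

lemma vector_space_times: "vector_space ((*) :: 'f::field \<Rightarrow> 'f \<Rightarrow> 'f)"
  by unfold_locales (auto simp: algebra_simps)

lemma prod_scale:
  assumes "module s" "module t"
  shows "module_prod.scale s t = (\<lambda>c (x, y). (s c x, t c y))"
proof -
  interpret module_prod s t
    using assms by (simp add: module_pair_def module_prod_def)
  show ?thesis
    by (auto simp: fun_eq_iff scale_def)
qed

lemma vector_space_prod_scale:
  assumes "vector_space s" "vector_space t"
  shows "vector_space (module_prod.scale s t)"
proof -
  have "module s" "module t"
    using assms by (simp_all add: module_iff_vector_space)
  then show ?thesis
    using assms unfolding prod_scale[OF \<open>module s\<close> \<open>module t\<close>]
    by (auto simp: vector_space_def)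
qed

lemma module_subspace_iff:
  assumes "vector_space s"
  shows "module.subspace s V \<longleftrightarrow>
    0 \<in> V \<and> (\<forall>x\<in>V. \<forall>y\<in>V. x + y \<in> V) \<and> (\<forall>c. \<forall>x\<in>V. s c x \<in> V)"
  using assms by (simp add: module.subspace_def module_iff_vector_space)

text \<open>Adjoining one generator \<open>a\<close> adds only the translates of the old span by
  multiples of \<open>a\<close>, and a finite field offers finitely many of these; induction on the
  generators does the rest.\<close>

lemma finite_span:
  fixes s :: "'f::{field,finite} \<Rightarrow> 'v::ab_group_add \<Rightarrow> 'v"
  assumes "vector_space s" "finite B"
  shows "finite (module.span s B)"
proof -
  interpret vector_space s by fact
  show ?thesis
    using assms(2)
  proof induction
    case empty
    then show ?case by simp
  next
    case (insert a B)
    have "span (insert a B) \<subseteq> (\<Union>k. (\<lambda>y. y + s k a) ` span B)"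
    proof
      fix x assume "x \<in> span (insert a B)"
      then obtain k where "x - s k a \<in> span B"
        by (auto simp: span_insert)
      moreover have "x = (x - s k a) + s k a" by simp
      ultimately show "x \<in> (\<Union>k. (\<lambda>y. y + s k a) ` span B)" by blast
    qed
    moreover have "finite (\<Union>k. (\<lambda>y. y + s k a) ` span B)"
      using insert by auto
    ultimately show ?case by (rule finite_subset)
  qed
qed

text \<open>A finite subspace spans itself, and \<open>finite_span\<close> gives the converse.
  Finite dimension is handled below as finiteness of the carrier.\<close>

lemma fin_dim_space_iff_finite:
  fixes s :: "'f::{field,finite} \<Rightarrow> 'v::ab_group_add \<Rightarrow> 'v"
  assumes "vector_space s"
  shows "fin_dim_space s V \<longleftrightarrow> module.subspace s V \<and> finite V"
proof -
  interpret vector_space s by fact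
  show ?thesis
    unfolding fin_dim_space_def
    by (metis assms finite_span span_eq_iff)
qed

section \<open>Functionals on a carrier\<close>

lemma subspace_dual:
  assumes "vector_space s"
  shows "module.subspace fun_scale (dual s V)"
  unfolding module_subspace_iff[OF vector_space_fun_scale]
  by (auto simp: dual_def linear_on_def fun_scale_def algebra_simps)

lemma dual_add: "\<phi> \<in> dual s V \<Longrightarrow> x \<in> V \<Longrightarrow> y \<in> V \<Longrightarrow> \<phi> (x + y) = \<phi> x + \<phi> y"
  by (auto simp: dual_def linear_on_def)

lemma dual_scale: "\<phi> \<in> dual s V \<Longrightarrow> x \<in> V \<Longrightarrow> \<phi> (s c x) = c * \<phi> x"
  by (auto simp: dual_def linear_on_def)

lemma dual_outside: "\<phi> \<in> dual s V \<Longrightarrow> x \<notin> V \<Longrightarrow> \<phi> x = 0"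
  by (auto simp: dual_def)

lemma dual_zero:
  assumes "vector_space s" "module.subspace s V" "\<phi> \<in> dual s V"
  shows "\<phi> 0 = 0"
  using assms dual_add[of \<phi> s V 0 0] module_subspace_iff[of s V] by (metis add_cancel_right_left)

lemma subspace_minus:
  assumes "vector_space s" "module.subspace s V" "x \<in> V"
  shows "- x \<in> V"
  using assms module.subspace_neg module_iff_vector_space by blast

lemma subspace_diff:
  assumes "vector_space s" "module.subspace s V" "x \<in> V" "y \<in> V"
  shows "x - y \<in> V"
  using assms module.subspace_diff module_iff_vector_space by blast

lemma dual_minus:
  assumes "vector_space s" "module.subspace s V" "\<phi> \<in> dual s V" "x \<in> V"
  shows "\<phi> (- x) = - \<phi> x"
  using dual_add[OF assms(3,4) subspace_minus[OF assms(1,2,4)]] dual_zero[OF assms(1-3)]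
  by (simp add: add_eq_0_iff)

lemma dual_diff:
  assumes "vector_space s" "module.subspace s V" "\<phi> \<in> dual s V" "x \<in> V" "y \<in> V"
  shows "\<phi> (x - y) = \<phi> x - \<phi> y"
  using dual_add[OF assms(3,4) subspace_minus[OF assms(1,2,5)]] dual_minus[OF assms(1-3,5)]
  by simp

text \<open>Coordinates are the values at the points of \<open>G\<close>, so that the parametrization is a restriction.\<close>

lemma coordinate_space:
  fixes W :: "('g \<Rightarrow> 'f::{field,finite}) set"
  assumes "finite G" "module.subspace fun_scale W" "\<And>\<phi> x. \<phi> \<in> W \<Longrightarrow> x \<notin> G \<Longrightarrow> \<phi> x = 0"
  obtains H :: "(nat \<Rightarrow> 'f) set" and B
  where "fin_dim_space fun_scale H" "linear_on fun_scale fun_scale H W B" "bij_betw B H W"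
proof -
  obtain e :: "'g \<Rightarrow> nat" where e: "inj_on e G"
    using finite_imp_inj_to_nat_seg[OF assms(1)] by blast
  define B where "B v = (\<lambda>x. if x \<in> G then v (e x) else 0)" for v :: "nat \<Rightarrow> 'f"
  \<comment> \<open>Sequences in \<open>H\<close> vanish at the indices that number no point of
    \<open>G\<close>. This makes \<open>B\<close> injective on \<open>H\<close> and leaves only
    finitely many sequences.\<close>
  define H where "H = {v. B v \<in> W \<and> (\<forall>i. i \<notin> e ` G \<longrightarrow> v i = 0)}"
  have B0: "B 0 = 0" and B_add: "B (v + w) = B v + B w"
    and B_scale: "B (fun_scale c v) = fun_scale c (B v)" for v w c
    by (auto simp: B_def fun_eq_iff fun_scale_def)
  have W: "0 \<in> W" "\<And>x y. x \<in> W \<Longrightarrow> y \<in> W \<Longrightarrow> x + y \<in> W" "\<And>c x. x \<in> W \<Longrightarrow> fun_scale c x \<in> W"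
    using assms(2) by (auto simp: module_subspace_iff[OF vector_space_fun_scale])
  have subspace: "module.subspace fun_scale H"
    unfolding module_subspace_iff[OF vector_space_fun_scale]
    by (auto simp: H_def B0 B_add B_scale W) (auto simp: fun_scale_def)
  have "H \<subseteq> {v. \<forall>i. i \<notin> e ` G \<longrightarrow> v i = 0}"
    by (auto simp: H_def)
  moreover have "finite {v :: nat \<Rightarrow> 'f. \<forall>i. (i \<in> e ` G \<longrightarrow> v i \<in> UNIV) \<and> (i \<notin> e ` G \<longrightarrow> v i = 0)}"
    using assms(1) by (intro finite_set_of_finite_funs) auto
  ultimately have "finite H"
    by (simp add: finite_subset)
  with subspace have fin: "fin_dim_space fun_scale H"
    by (simp add: fin_dim_space_iff_finite[OF vector_space_fun_scale])
  have "inj_on B H"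
  proof (rule inj_onI)
    fix v w assume vw: "v \<in> H" "w \<in> H" "B v = B w"
    show "v = w"
    proof
      fix i
      show "v i = w i"
      proof (cases "i \<in> e ` G")
        case True
        then obtain x where "x \<in> G" "i = e x" by blast
        then show ?thesis using fun_cong[OF vw(3), of x] by (simp add: B_def)
      next
        case False
        then show ?thesis using vw by (simp add: H_def)
      qed
    qed
  qed
  moreover have "\<phi> \<in> B ` H" if "\<phi> \<in> W" for \<phi>
  proof -
    define v where "v i = (if i \<in> e ` G then \<phi> (inv_into G e i) else 0)" for i
    have "B v = \<phi>"
      using assms(3)[OF that] e by (auto simp: B_def v_def fun_eq_iff)
    moreover from this have "v \<in> H"
      using that by (simp add: H_def v_def)
    ultimately show ?thesis by blast
  qed
  ultimately have "bij_betw B H W"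
    by (auto simp: bij_betw_def H_def)
  moreover have "linear_on fun_scale fun_scale H W B"
    by (auto simp: linear_on_def B_add B_scale H_def)
  ultimately show thesis
    using that fin by blast
qed

text \<open>A basis of \<open>P\<close> stays independent after \<open>y\<close> is adjoined, so a
  linear map may be prescribed as 1 at \<open>y\<close> and 0 on the basis. Cutting it off outside
  \<open>V\<close> puts it into the dual.\<close>

lemma exists_separating_functional:
  assumes "vector_space s" "module.subspace s V" "module.subspace s P" "P \<subseteq> V" "y \<in> V" "y \<notin> P"
  obtains \<phi> where "\<phi> \<in> dual s V" "\<And>x. x \<in> P \<Longrightarrow> \<phi> x = 0" "\<phi> y = 1"
proof -
  interpret vector_space_pair s "(*)"
    using assms(1) vector_space_times by (simp add: vector_space_pair_def)
  obtain B where B: "B \<subseteq> P" "vs1.independent B" "P \<subseteq> vs1.span B"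
    using vs1.maximal_independent_subset by blast
  with assms(3) have "vs1.span B = P"
    by (simp add: vs1.span_minimal subset_antisym)
  have "vs1.independent (insert y B)"
    using assms(6) B(2) \<open>vs1.span B = P\<close> vs1.independent_insertI by metis
  have "y \<notin> B"
    using assms(6) B(1) by blast
  obtain f where f: "Vector_Spaces.linear s (*) f" "\<forall>x\<in>insert y B. f x = (if x = y then 1 else 0)"
    using linear_independent_extend[OF \<open>vs1.independent (insert y B)\<close>,
        of "\<lambda>x. if x = y then 1 else 0"] by blast
  interpret f: Vector_Spaces.linear s "(*)" f by fact
  have "f x = 0" if "x \<in> P" for x
  proof (rule f.eq_0_on_span)
    show "x \<in> vs1.span B" using that \<open>vs1.span B = P\<close> by simp
    show "f b = 0" if "b \<in> B" for b using that f(2) \<open>y \<notin> B\<close> by auto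
  qed
  moreover have "(\<lambda>x. if x \<in> V then f x else 0) \<in> dual s V"
    using assms(1,2) by (auto simp: dual_def linear_on_def module_subspace_iff f.add f.scale)
  ultimately show thesis
    using that[of "\<lambda>x. if x \<in> V then f x else 0"] assms(4,5) f(2) by auto
qed

text \<open>On the subspace \<open>S\<close> the linear map \<open>snd\<close> has a linear right
  inverse, defined on the whole ambient space with values in \<open>S\<close>. Its components are
  \<open>L\<close> and \<open>p\<close>, so \<open>p\<close> projects onto the image of
  \<open>S\<close>.\<close>

lemma exists_linear_section:
  assumes "vector_space s" "vector_space t" "module.subspace (module_prod.scale t s) S"
  obtains L p where "Vector_Spaces.linear s t L" "Vector_Spaces.linear s s p"
    "\<And>x. (L x, p x) \<in> S" "\<And>x. x \<in> snd ` S \<Longrightarrow> p x = x"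
proof -
  have m: "module t" "module s"
    using assms by (simp_all add: module_iff_vector_space)
  interpret P: vector_space_pair "module_prod.scale t s" s
    using assms(1,2) by (simp add: vector_space_pair_def vector_space_prod_scale)
  have "Vector_Spaces.linear (module_prod.scale t s) s snd"
    unfolding Vector_Spaces.linear_iff
    using vector_space_prod_scale[OF assms(2,1)] assms by (auto simp: prod_scale[OF m])
  from P.linear_exists_right_inverse_on[OF this assms(3)]
  obtain \<sigma> where \<sigma>: "range \<sigma> \<subseteq> S" "Vector_Spaces.linear s (module_prod.scale t s) \<sigma>"
    "\<forall>x\<in>snd ` S. snd (\<sigma> x) = x"
    by blast
  have "Vector_Spaces.linear s t (fst \<circ> \<sigma>)" "Vector_Spaces.linear s s (snd \<circ> \<sigma>)"
    using \<sigma>(2) assms(1,2) unfolding Vector_Spaces.linear_iff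
    by (auto simp: prod_scale[OF m] case_prod_beta)
  then show thesis
    using that[of "fst \<circ> \<sigma>" "snd \<circ> \<sigma>"] \<sigma> by auto
qed

section \<open>Characters\<close>

text \<open>Nontriviality comes from injectivity of \<open>chi\<close>: the character
  \<open>chi 0\<close> is trivial, so \<open>chi 1\<close> is not. This is what later lets character
  sums detect subspaces.\<close>

lemma self_duality_one:
  assumes "symmetric_self_duality (chi :: 'f::field \<Rightarrow> 'f \<Rightarrow> complex)"
  shows "chi 1 (a + b) = chi 1 a * chi 1 b" "cmod (chi 1 a) = 1" "\<exists>t. chi 1 t \<noteq> 1"
proof -
  have chi: "chi 1 \<in> additive_characters" "inj chi"
    "\<And>a b. chi (a + b) = (\<lambda>c. chi a c * chi b c)" "\<And>a. chi a \<in> additive_characters"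
    using assms by (auto simp: symmetric_self_duality_def bij_betw_def)
  then show "chi 1 (a + b) = chi 1 a * chi 1 b" "cmod (chi 1 a) = 1"
    by (auto simp: additive_characters_def)
  have "chi 0 c = 1" for c
  proof -
    have "chi 0 c * chi 0 c = chi 0 c" "chi 0 c \<noteq> 0"
      using chi(3)[of 0 0] chi(4)[of 0] by (auto simp: additive_characters_def fun_eq_iff) 
        (metis norm_zero zero_neq_one)
    then show ?thesis by simp
  qed
  moreover have "chi 0 \<noteq> chi 1"
    using chi(2) by (auto dest: injD)
  ultimately show "\<exists>t. chi 1 t \<noteq> 1"
    by (auto simp: fun_eq_iff)
qed

section \<open>Orthogonality of characters and Fourier expansion\<close>

lemma additive_exponential:
  fixes e :: "'f::ab_group_add \<Rightarrow> complex"
  assumes "\<And>a b. e (a + b) = e a * e b" "\<And>a. cmod (e a) = 1"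
  shows "e 0 = 1" "e a \<noteq> 0" "e (- a) = inverse (e a)"
proof -
  show nz: "e a \<noteq> 0" for a
    using assms(2)[of a] by auto
  show "e 0 = 1"
    using assms(1)[of 0 0] nz[of 0] by simp
  then have "e a * e (- a) = 1"
    using assms(1)[of a "- a"] by simp
  then show "e (- a) = inverse (e a)"
    by (metis inverse_unique)
qed

text \<open>Translating by an element \<open>y\<close> with \<open>c y\<close> different from 1
  permutes \<open>F\<close> but multiplies the sum by \<open>c y\<close>, so the sum
  vanishes.\<close>

lemma character_sum:
  fixes c :: "'v::ab_group_add \<Rightarrow> complex"
  assumes "\<And>x y. x \<in> F \<Longrightarrow> y \<in> F \<Longrightarrow> x + y \<in> F" "\<And>x. x \<in> F \<Longrightarrow> - x \<in> F"
    and "\<And>x y. x \<in> F \<Longrightarrow> y \<in> F \<Longrightarrow> c (x + y) = c x * c y"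
  shows "(\<Sum>x\<in>F. c x) = (if \<forall>x\<in>F. c x = 1 then of_nat (card F) else 0)"
proof (cases "\<forall>x\<in>F. c x = 1")
  case False
  then obtain y where y: "y \<in> F" "c y \<noteq> 1" by blast
  have diff: "x - y \<in> F" if "x \<in> F" for x
    using assms(1)[OF that assms(2)[OF y(1)]] by simp
  have "(\<Sum>x\<in>F. c x) = (\<Sum>x\<in>F. c (y + x))"
    by (rule sum.reindex_bij_witness[of _ "\<lambda>x. y + x" "\<lambda>x. x - y"]) (use y assms diff in auto)
  also have "\<dots> = c y * (\<Sum>x\<in>F. c x)"
    using y assms by (simp add: sum_distrib_left)
  finally have "(c y - 1) * (\<Sum>x\<in>F. c x) = 0"
    by (simp add: algebra_simps)
  with y False show ?thesis by auto
qed auto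

text \<open>This is the double annihilator property in the form of a sum. For \<open>y\<close>
  outside \<open>P\<close> some functional in \<open>W\<close> is 1 at \<open>y\<close>; its
  multiples take every value there, so \<open>e (\<phi> y)\<close> is a nontrivial character of
  \<open>W\<close> and its sum is zero.\<close>

lemma sum_over_annihilator:
  fixes s :: "'f::{field,finite} \<Rightarrow> 'v::ab_group_add \<Rightarrow> 'v" and e :: "'f \<Rightarrow> complex"
  assumes s: "vector_space s" and G: "module.subspace s G" and P: "module.subspace s P" "P \<subseteq> G"
    and e: "\<And>a b. e (a + b) = e a * e b" "\<And>a. cmod (e a) = 1" "\<exists>t. e t \<noteq> 1"
    and y: "y \<in> G"
  defines "W \<equiv> {\<phi> \<in> dual s G. \<forall>x\<in>P. \<phi> x = 0}"
  shows "(\<Sum>\<phi>\<in>W. e (\<phi> y)) = (if y \<in> P then of_nat (card W) else 0)"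
proof -
  have W: "\<phi> + \<psi> \<in> W" "fun_scale c \<phi> \<in> W" "- \<phi> \<in> W" if "\<phi> \<in> W" "\<psi> \<in> W" for \<phi> \<psi> c
    using that subspace_dual[OF s, of G] subspace_minus[OF vector_space_fun_scale subspace_dual[OF s], of _ G]
    by (auto simp: W_def module_subspace_iff[OF vector_space_fun_scale] fun_scale_def)
  have sum: "(\<Sum>\<phi>\<in>W. e (\<phi> y)) = (if \<forall>\<phi>\<in>W. e (\<phi> y) = 1 then of_nat (card W) else 0)"
    by (intro character_sum) (use W e in auto)
  have "(\<forall>\<phi>\<in>W. e (\<phi> y) = 1) \<longleftrightarrow> y \<in> P"
  proof
    assume "y \<in> P"
    then show "\<forall>\<phi>\<in>W. e (\<phi> y) = 1"
      using additive_exponential(1)[OF e(1,2)] by (simp add: W_def)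
  next
    assume triv: "\<forall>\<phi>\<in>W. e (\<phi> y) = 1"
    show "y \<in> P"
    proof (rule ccontr)
      assume "y \<notin> P"
      then obtain \<phi> where \<phi>: "\<phi> \<in> dual s G" "\<And>x. x \<in> P \<Longrightarrow> \<phi> x = 0" "\<phi> y = 1"
        using exists_separating_functional[OF s G P y] by metis
      then have "\<phi> \<in> W" by (simp add: W_def)
      then have "e (fun_scale t \<phi> y) = 1" for t
        using W triv by blast
      with \<phi>(3) e(3) show False
        by (simp add: fun_scale_def)
    qed
  qed
  with sum show ?thesis by simp
qed

text \<open>This is Fourier inversion on the quotient of \<open>G\<close> by \<open>P\<close>: the
  annihilator of \<open>P\<close> is the dual of that quotient, and \<open>u\<close> is a function
  on it.\<close>

lemma Fourier_expansion_invariant: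
  fixes s :: "'f::{field,finite} \<Rightarrow> 'v::ab_group_add \<Rightarrow> 'v" and e :: "'f \<Rightarrow> complex"
    and u :: "'v \<Rightarrow> complex"
  assumes s: "vector_space s" and G: "module.subspace s G" "finite G"
    and P: "module.subspace s P" "P \<subseteq> G"
    and e: "\<And>a b. e (a + b) = e a * e b" "\<And>a. cmod (e a) = 1" "\<exists>t. e t \<noteq> 1"
    and B: "bij_betw B H {\<phi> \<in> dual s G. \<forall>x\<in>P. \<phi> x = 0}" and "finite H" "H \<noteq> {}"
    and u: "\<And>x y. x \<in> G \<Longrightarrow> y \<in> P \<Longrightarrow> u (x - y) = u x"
  obtains \<psi> where "\<And>h. h \<notin> H \<Longrightarrow> \<psi> h = 0" "\<And>x. x \<in> G \<Longrightarrow> (\<Sum>h\<in>H. e (B h x) * \<psi> h) = u x"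
proof -
  \<comment> \<open>The sum over \<open>H\<close> contributes \<open>card H\<close> when
    \<open>x - y\<close> lies in \<open>P\<close>. The coefficients sum over all of \<open>G\<close>
    instead of the quotient, so each coset is counted \<open>card P\<close> times.\<close>
  define N :: complex where "N = of_nat (card H) * of_nat (card P)"
  define \<psi> where "\<psi> h = (if h \<in> H then (\<Sum>y\<in>G. u y * e (- B h y)) / N else 0)" for h
  have "P \<noteq> {}" "finite P"
    using P G by (auto simp: module_subspace_iff[OF s] intro: finite_subset)
  then have N: "N \<noteq> 0"
    using assms by (simp add: N_def)
  have Bd: "B h \<in> dual s G" if "h \<in> H" for h
    using B that by (auto simp: bij_betw_def)
  have "(\<Sum>h\<in>H. e (B h x) * \<psi> h) = u x" if x: "x \<in> G" for x
  proof -
    have "(\<Sum>h\<in>H. e (B h x) * \<psi> h) = (\<Sum>h\<in>H. \<Sum>y\<in>G. u y * e (B h (x - y))) / N"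
      unfolding sum_divide_distrib
    proof (rule sum.cong)
      fix h assume h: "h \<in> H"
      have "e (B h x) * (u y * e (- B h y)) = u y * e (B h (x - y))" if "y \<in> G" for y
        using e(1)[of "B h x" "- B h y"] dual_diff[OF s G(1) Bd[OF h] x that] by simp
      then show "e (B h x) * \<psi> h = (\<Sum>y\<in>G. u y * e (B h (x - y)) / N)"
        unfolding \<psi>_def sum_divide_distrib if_P[OF h] sum_distrib_left times_divide_eq_right
        by (intro sum.cong) auto
    qed simp
    also have "(\<Sum>h\<in>H. \<Sum>y\<in>G. u y * e (B h (x - y))) = (\<Sum>y\<in>G. u y * (\<Sum>h\<in>H. e (B h (x - y))))"
      by (subst sum.swap) (simp add: sum_distrib_left)
    also have "\<dots> = (\<Sum>y\<in>G. if x - y \<in> P then u x * of_nat (card H) else 0)"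
    proof (rule sum.cong)
      fix y assume y: "y \<in> G"
      have "x - y \<in> G"
        using subspace_diff[OF s G(1)] x y by blast
      have "(\<Sum>h\<in>H. e (B h (x - y))) = (if x - y \<in> P then of_nat (card H) else 0)"
        using sum_over_annihilator[OF s G(1) P e \<open>x - y \<in> G\<close>] bij_betw_same_card[OF B]
          sum.reindex_bij_betw[OF B, of "\<lambda>\<phi>. e (\<phi> (x - y))"] by simp
      moreover have "u y = u x" if "x - y \<in> P"
        using u[OF x that] by simp
      ultimately show "u y * (\<Sum>h\<in>H. e (B h (x - y))) = (if x - y \<in> P then u x * of_nat (card H) else 0)"
        by auto
    qed simp
    also have "\<dots> = (\<Sum>y\<in>{y\<in>G. x - y \<in> P}. u x * of_nat (card H))"
      using G(2) by (simp add: sum.If_cases Int_def)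
    also have "\<dots> = u x * N"
    proof -
      have "bij_betw (\<lambda>y. x - y) {y\<in>G. x - y \<in> P} P"
        by (rule bij_betw_byWitness[of _ "\<lambda>y. x - y"])
          (use x P subspace_diff[OF s G(1)] in auto)
      from bij_betw_same_card[OF this] show ?thesis by (simp add: N_def)
    qed
    finally show ?thesis using N by simp
  qed
  then show thesis
    using that[of \<psi>] by (simp add: \<psi>_def)
qed

section \<open>Weyl algebras\<close>

lemma weyl_zero: "weyl chi V 0 = L2_id V" if "chi 1 0 = (1 :: complex)"
  using that by (auto simp: weyl_def L2_id_def fun_eq_iff zero_prod_def)

text \<open>The phase of the second operator is evaluated after the shift by the first, at
  \<open>x - g\<close> instead of \<open>x\<close>; the difference is the factor
  \<open>chi 1 (- \<phi>' g)\<close>.\<close>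

lemma weyl_comp:
  assumes e: "\<And>a b. chi 1 (a + b) = chi 1 a * (chi 1 b :: complex)"
    and s: "vector_space s" and V: "module.subspace s V"
    and p: "p \<in> dual s V \<times> V" and q: "q \<in> dual s V \<times> V"
  shows "weyl chi V p \<circ> weyl chi V q = (\<lambda>\<psi> x. chi 1 (- fst q (snd p)) * weyl chi V (p + q) \<psi> x)"
proof -
  obtain \<phi> g \<phi>' g' where pq: "p = (\<phi>, g)" "q = (\<phi>', g')"
    by (cases p; cases q)
  have "chi 1 (\<phi> x) * chi 1 (\<phi>' (x - g)) = chi 1 (- \<phi>' g) * chi 1 (\<phi> x + \<phi>' x)" if "x \<in> V" for x
  proof -
    have "\<phi> x + \<phi>' (x - g) = - \<phi>' g + (\<phi> x + \<phi>' x)"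
      using dual_diff[OF s V, of \<phi>' x g] p q that by (simp add: pq)
    then show ?thesis by (metis e)
  qed
  then show ?thesis
    using subspace_diff[OF s V] p
    by (auto simp: weyl_def pq fun_eq_iff diff_diff_eq add.commute)
qed

text \<open>Operators are plain maps here, so linearity is not built in. Homogeneity is the part of
  it that lets a product act on an eigenvector.\<close>

lemma weyl_algebra_homogeneous:
  "a \<in> weyl_algebra chi V S \<Longrightarrow> a (\<lambda>x. c * \<psi> x) = (\<lambda>x. c * a \<psi> x)"
proof (induction arbitrary: c \<psi> rule: weyl_algebra.induct)
  case unit
  then show ?case by (auto simp: L2_id_def)
next
  case (gen p)
  then show ?case by (auto simp: weyl_def fun_eq_iff split: prod.splits)
next
  case (add a b)
  then show ?case by (auto simp: algebra_simps)
next
  case (scale a d)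
  then show ?case by (auto simp: algebra_simps)
next
  case (mult a b)
  then show ?case by simp
qed

lemma joint_eigenvector:
  assumes "\<psi> \<in> L2 V" "\<And>p. p \<in> S \<Longrightarrow> \<exists>z. weyl chi V p \<psi> = (\<lambda>x. z * \<psi> x)"
    and "a \<in> weyl_algebra chi V S"
  shows "\<exists>z. a \<psi> = (\<lambda>x. z * \<psi> x)"
  using assms(3)
proof (induction)
  case unit
  show ?case using assms(1) by (intro exI[of _ 1]) (auto simp: L2_id_def L2_def fun_eq_iff)
next
  case (gen p)
  then show ?case by (rule assms(2))
next
  case (add a b)
  then show ?case by (auto simp: fun_eq_iff) (metis distrib_right)
next
  case (scale a c)
  then show ?case by (auto simp: mult.assoc[symmetric])
next
  case (mult a b)
  then obtain z w where "a \<psi> = (\<lambda>x. z * \<psi> x)" "b \<psi> = (\<lambda>x. w * \<psi> x)" by blast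
  then have "(a \<circ> b) \<psi> = (\<lambda>x. (w * z) * \<psi> x)"
    using weyl_algebra_homogeneous[OF mult.hyps(1), of w \<psi>] by (simp add: mult.assoc)
  then show ?case by blast
qed

text \<open>Eigenvalues at a joint eigenvector add and multiply with the operators, and the
  normalization \<open>\<psi> x = 1\<close> reads them off as values at \<open>x\<close>. A
  character is thus obtained without studying the relations between the generators.\<close>

lemma algebra_character_of_eigenvector:
  assumes \<psi>: "\<psi> \<in> L2 V" "\<And>p. p \<in> S \<Longrightarrow> \<exists>z. weyl chi V p \<psi> = (\<lambda>x. z * \<psi> x)"
    and x: "x \<in> V" "\<psi> x = 1"
  shows "algebra_character V (weyl_algebra chi V S) (\<lambda>a. a \<psi> x)"
proof -
  have eig: "a \<psi> = (\<lambda>y. a \<psi> x * \<psi> y)" if "a \<in> weyl_algebra chi V S" for a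
    using joint_eigenvector[OF \<psi> that] x(2) by force
  have "(a \<circ> b) \<psi> x = a \<psi> x * b \<psi> x" if "a \<in> weyl_algebra chi V S" "b \<in> weyl_algebra chi V S" for a b
  proof -
    have "(a \<circ> b) \<psi> x = a (\<lambda>y. b \<psi> x * \<psi> y) x"
      by (subst eig[OF that(2), symmetric]) simp
    also have "\<dots> = b \<psi> x * a \<psi> x"
      by (simp add: weyl_algebra_homogeneous[OF that(1)])
    finally show ?thesis by simp
  qed
  then show ?thesis
    using x by (auto simp: algebra_character_def L2_id_def)
qed

text \<open>
  A quadratic phase \<open>t\<close> whose polarization is \<open>\<Gamma>\<close> gives the joint eigenvector \<open>x \<mapsto> t (- x)\<close> of
  the operators \<open>w(\<Gamma> v, v)\<close>; the eigenvalue at \<open>v\<close> is \<open>t v\<close>.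
\<close>

lemma graph_phase_of_quadratic:
  fixes \<Gamma> :: "'v::ab_group_add \<Rightarrow> 'v \<Rightarrow> 'f::field" and chi :: "'f \<Rightarrow> 'f \<Rightarrow> complex"
  assumes e: "\<And>a b. chi 1 (a + b) = chi 1 a * chi 1 b" "\<And>a. cmod (chi 1 a) = 1"
    and s: "vector_space s" and V: "module.subspace s V"
    and \<Gamma>: "\<And>v. v \<in> V \<Longrightarrow> \<Gamma> v \<in> dual s V"
    and t: "t 0 = 1" "\<And>x y. x \<in> V \<Longrightarrow> y \<in> V \<Longrightarrow> t (x + y) = t x * t y * chi 1 (\<Gamma> x y)"
  obtains \<tau>' where
    "algebra_character V (weyl_algebra chi V (graph_subspace V \<Gamma>)) \<tau>'"
    "\<And>v. v \<in> V \<Longrightarrow> graph_phase chi V \<Gamma> \<tau>' v = t v"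
proof -
  define \<psi> where "\<psi> x = (if x \<in> V then t (- x) else 0)" for x
  note e0 = additive_exponential[OF e]
  have V0: "0 \<in> V" using V by (simp add: module_subspace_iff[OF s])
  have eig: "weyl chi V (\<Gamma> v, v) \<psi> = (\<lambda>x. t v * \<psi> x)" if v: "v \<in> V" for v
  proof
    fix x
    show "weyl chi V (\<Gamma> v, v) \<psi> x = t v * \<psi> x"
    proof (cases "x \<in> V")
      case True
      have "x - v \<in> V" "- x \<in> V"
        using True v subspace_diff[OF s V] subspace_minus[OF s V] by auto
      \<comment> \<open>The translate \<open>\<psi> (x - v)\<close> is \<open>t (v - x)\<close>; the
        inverse factor produced by the polarization cancels the multiplier of the Weyl
        operator.\<close>
      moreover have "t (v - x) = t v * t (- x) * inverse (chi 1 (\<Gamma> v x))"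
        using t(2)[OF v \<open>- x \<in> V\<close>] dual_minus[OF s V \<Gamma>[OF v] True] e0(3) by simp
      ultimately show ?thesis
        using True e0(2) by (simp add: weyl_def \<psi>_def)
    qed (simp add: weyl_def \<psi>_def)
  qed
  have "algebra_character V (weyl_algebra chi V (graph_subspace V \<Gamma>)) (\<lambda>a. a \<psi> 0)"
    by (rule algebra_character_of_eigenvector)
      (use eig V0 t(1) in \<open>auto simp: \<psi>_def L2_def graph_subspace_def\<close>)
  moreover have "graph_phase chi V \<Gamma> (\<lambda>a. a \<psi> 0) v = t v" if "v \<in> V" for v
    using eig[OF that] V0 t(1) by (simp add: graph_phase_def \<psi>_def)
  ultimately show thesis by (rule that)
qed

text \<open>The eigenvalue equations pass to sums, multiples and products, and
  \<open>\<zeta>\<close> respects these operations, so the generators decide membership.\<close>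

lemma stabilizer_space_iff:
  assumes "algebra_character V (weyl_algebra chi V S) \<zeta>"
  shows "\<psi> \<in> stabilizer_space chi V \<zeta> S \<longleftrightarrow>
    \<psi> \<in> L2 V \<and> (\<forall>p\<in>S. weyl chi V p \<psi> = (\<lambda>x. \<zeta> (weyl chi V p) * \<psi> x))"
proof
  assume R: "\<psi> \<in> L2 V \<and> (\<forall>p\<in>S. weyl chi V p \<psi> = (\<lambda>x. \<zeta> (weyl chi V p) * \<psi> x))"
  have "a \<psi> = (\<lambda>x. \<zeta> a * \<psi> x)" if "a \<in> weyl_algebra chi V S" for a
    using that
  proof induction
    case unit
    then show ?case
      using R assms by (auto simp: algebra_character_def L2_id_def L2_def fun_eq_iff)
  next
    case (gen p)
    then show ?case using R by blast
  next
    case (add a b)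
    then show ?case using assms by (auto simp: algebra_character_def algebra_simps)
  next
    case (scale a c)
    then show ?case using assms by (auto simp: algebra_character_def)
  next
    case (mult a b)
    then have "\<zeta> (a \<circ> b) = \<zeta> a * \<zeta> b"
      using assms by (auto simp: algebra_character_def)
    moreover have "(a \<circ> b) \<psi> = (\<lambda>x. \<zeta> b * (\<zeta> a * \<psi> x))"
      using mult.IH weyl_algebra_homogeneous[OF mult.hyps(1), of "\<zeta> b" \<psi>] by simp
    ultimately show ?case by (simp only: mult_ac)
  qed
  then show "\<psi> \<in> stabilizer_space chi V \<zeta> S"
    using R by (simp add: stabilizer_space_def)
qed (auto simp: stabilizer_space_def weyl_algebra.gen)

text \<open>Applying \<open>\<zeta>\<close> to the composition law shows that it is multiplicative
  on \<open>S\<close> up to a phase. On pairs \<open>(k, 0)\<close> the phase is trivial, so there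
  \<open>\<zeta>\<close> gives an honest character.\<close>

lemma character_weyl_mult:
  assumes e: "\<And>a b. chi 1 (a + b) = chi 1 a * (chi 1 b :: complex)"
    and s: "vector_space s" and V: "module.subspace s V"
    and \<zeta>: "algebra_character V (weyl_algebra chi V S) \<zeta>"
    and S: "S \<subseteq> dual s V \<times> V" "p \<in> S" "q \<in> S" "p + q \<in> S"
  shows "\<zeta> (weyl chi V p) * \<zeta> (weyl chi V q) = chi 1 (- fst q (snd p)) * \<zeta> (weyl chi V (p + q))"
proof -
  have gen: "weyl chi V r \<in> weyl_algebra chi V S" if "r \<in> S" for r
    using that by (rule weyl_algebra.gen)
  have "\<zeta> (weyl chi V p) * \<zeta> (weyl chi V q) = \<zeta> (weyl chi V p \<circ> weyl chi V q)"
    using \<zeta> gen S by (simp add: algebra_character_def)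
  also have "\<dots> = \<zeta> (\<lambda>\<psi> x. chi 1 (- fst q (snd p)) * weyl chi V (p + q) \<psi> x)"
    using weyl_comp[where chi = chi, OF e s V, of p q] subsetD[OF S(1)] S(2,3) by simp
  also have "\<dots> = chi 1 (- fst q (snd p)) * \<zeta> (weyl chi V (p + q))"
    using \<zeta> gen[OF S(4)] by (simp add: algebra_character_def)
  finally show ?thesis .
qed

section \<open>Graph codes\<close>

text \<open>
  The section \<open>x \<mapsto> (L x, p x)\<close> of \<open>S\<close> over the projection \<open>p\<close> onto \<open>snd ` S\<close> prescribes the form
  only on pairs with one argument in \<open>snd ` S\<close>. Letting it vanish on pairs from the kernel of \<open>p\<close>
  gives \<open>A\<close>, and then the phase extends without dividing a quadratic form by 2, so characteristic
  2 needs no special treatment.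
\<close>

lemma symmetric_phase_extension:
  fixes s :: "'f::field \<Rightarrow> 'v::ab_group_add \<Rightarrow> 'v" and e :: "'f \<Rightarrow> complex"
    and c :: "('v \<Rightarrow> 'f) \<times> 'v \<Rightarrow> complex"
  assumes s: "vector_space s" and V: "module.subspace s V" and S: "isotropic s V S"
    and e: "\<And>a b. e (a + b) = e a * e b" "\<And>a. cmod (e a) = 1"
    and c: "\<And>p q. p \<in> S \<Longrightarrow> q \<in> S \<Longrightarrow> c p * c q = e (- fst q (snd p)) * c (p + q)" "c 0 = 1"
  obtains A \<gamma> where
    "linear_on s fun_scale V (dual s V) A"
    "\<And>x y. x \<in> V \<Longrightarrow> y \<in> V \<Longrightarrow> A x y = A y x"
    "\<gamma> 0 = 1"
    "\<And>x y. x \<in> V \<Longrightarrow> y \<in> V \<Longrightarrow> \<gamma> (x + y) = \<gamma> x * \<gamma> y * e (A x y)"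
    "\<And>\<phi> g x. (\<phi>, g) \<in> S \<Longrightarrow> x \<in> V \<Longrightarrow> (\<And>k. (k, 0) \<in> S \<Longrightarrow> c (k, 0) = e (k x)) \<Longrightarrow>
      e (\<phi> x) * \<gamma> (x - g) = c (\<phi>, g) * \<gamma> x"
proof -
  note e0 = additive_exponential[OF e]
  have Sd: "\<phi> \<in> dual s V" "g \<in> V" if "(\<phi>, g) \<in> S" for \<phi> g
    using S that by (auto simp: isotropic_def)
  have Ssub: "module.subspace (module_prod.scale fun_scale s) S"
    using S by (simp add: isotropic_def)
  have iso: "\<phi> y = \<psi> x" if "(\<phi>, x) \<in> S" "(\<psi>, y) \<in> S" for \<phi> \<psi> x y
    using S that by (auto simp: isotropic_def)
  note VS = vector_space_prod_scale[OF vector_space_fun_scale s]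
  obtain L p where L: "Vector_Spaces.linear s fun_scale L" and p: "Vector_Spaces.linear s s p"
    and LpS: "\<And>x. (L x, p x) \<in> S" and p_id: "\<And>x. x \<in> snd ` S \<Longrightarrow> p x = x"
    using exists_linear_section[OF s vector_space_fun_scale Ssub] by metis
  have L_add: "L (x + y) = L x + L y" and L_scale: "L (s k x) = fun_scale k (L x)"
    and p_add: "p (x + y) = p x + p y" and p_scale: "p (s k x) = s k (p x)" for x y k
    using L p by (simp_all add: Vector_Spaces.linear_iff)
  have L0: "L 0 = 0" and p0: "p 0 = 0"
    using L_add[of 0 0] p_add[of 0 0] by simp_all
  have L_minus: "L (- x) = - L x" and p_minus: "p (- x) = - p x" for x
    using L_add[of x "- x"] p_add[of x "- x"] L0 p0 by (simp_all add: add_eq_0_iff)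
  have Ld: "L x \<in> dual s V" and pV: "p x \<in> V" for x
    using Sd LpS by blast+
  have Lp: "L x (p y) = L y (p x)" for x y
    using iso[OF LpS LpS] .
  note Ladd = dual_add[OF Ld] and Ldiff = dual_diff[OF s V Ld]
  \<comment> \<open>If \<open>p x = x\<close>, the last two terms cancel and the prescribed value
    \<open>L x y\<close> remains. The first two terms together are symmetric, and the third is
    symmetric by isotropy, in the form \<open>Lp\<close>.\<close>
  define A where "A x = (\<lambda>y. if y \<in> V then L x y + L y x - L y (p x) else 0)" for x
  \<comment> \<open>The signs are chosen so that \<open>\<gamma> (- g) = c (L g, g)\<close> for
    \<open>g\<close> in the projection of \<open>S\<close>. The second factor accounts for the part
    of \<open>x\<close> that \<open>p\<close> removes and is 1 where \<open>p x = x\<close>.\<close>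
  define \<gamma> where "\<gamma> x = c (- L x, - p x) * e (L x (x - p x))" for x
  have V_add: "x + y \<in> V" if "x \<in> V" "y \<in> V" for x y
    using V that by (simp add: module_subspace_iff[OF s])
  have V_scale: "s k x \<in> V" if "x \<in> V" for x k
    using V that by (simp add: module_subspace_iff[OF s])
  have A_lin: "linear_on s fun_scale V (dual s V) A"
  proof -
    have "A x \<in> dual s V" if "x \<in> V" for x
      using that by (auto simp: dual_def linear_on_def A_def Ladd V_add V_scale L_add L_scale
          dual_scale[OF Ld] fun_scale_def algebra_simps)
    moreover have "A (x + y) = A x + A y" if "x \<in> V" "y \<in> V" for x y
      using that pV by (auto simp: A_def fun_eq_iff L_add p_add Ladd)
    moreover have "A (s k x) = fun_scale k (A x)" if "x \<in> V" for x k
      using that pV by (auto simp: A_def fun_eq_iff L_scale p_scale dual_scale[OF Ld] fun_scale_def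
          algebra_simps)
    ultimately show ?thesis by (auto simp: linear_on_def)
  qed
  have A_sym: "A x y = A y x" if "x \<in> V" "y \<in> V" for x y
    using that by (simp add: A_def Lp[of y x])
  have neg: "(- L x, - p x) \<in> S" for x
    using LpS[of "- x"] by (simp add: L_minus p_minus)
  have \<gamma>_add: "\<gamma> (x + y) = \<gamma> x * \<gamma> y * e (A x y)" if x: "x \<in> V" and y: "y \<in> V" for x y
  proof -
    have "c (- L x, - p x) * c (- L y, - p y) = e (- ((- L y) (- p x))) * c (- L (x + y), - p (x + y))"
      using c(1)[OF neg[of x] neg[of y]] by (simp add: L_add p_add)
    then have "c (- L x, - p x) * c (- L y, - p y) = e (- L y (p x)) * c (- L (x + y), - p (x + y))"
      using dual_minus[OF s V Ld pV] by simp
    then have cc: "c (- L (x + y), - p (x + y)) = e (L y (p x)) * (c (- L x, - p x) * c (- L y, - p y))"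
      using e0 by (simp add: field_simps)
    have "x - p x \<in> V" "y - p y \<in> V"
      using x y pV subspace_diff[OF s V] by auto
    moreover have "L (x + y) (x + y - p (x + y)) = (L x + L y) ((x - p x) + (y - p y))"
      by (simp add: p_add L_add add_diff_add)
    \<comment> \<open>The phase from \<open>c\<close> and the cross terms of
      \<open>L (x + y)\<close> add up to exactly \<open>A x y\<close>; this is where the third term
      of \<open>A\<close> is used.\<close>
    ultimately have "L y (p x) + L (x + y) (x + y - p (x + y)) =
        L x (x - p x) + L y (y - p y) + A x y"
      using x y pV by (simp add: A_def Ladd Ldiff Lp[of x y])
    then have "e (L y (p x)) * e (L (x + y) (x + y - p (x + y))) =
        e (L x (x - p x)) * e (L y (y - p y)) * e (A x y)"
      by (metis e(1))
    then show ?thesis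
      unfolding \<gamma>_def cc by (simp add: mult_ac)
  qed
  have S_shift: "e (\<phi> x) * \<gamma> (x - g) = c (\<phi>, g) * \<gamma> x"
    if \<phi>g: "(\<phi>, g) \<in> S" and x: "x \<in> V" and k: "\<And>k. (k, 0) \<in> S \<Longrightarrow> c (k, 0) = e (k x)" for \<phi> g x
  proof -
    have pg: "p g = g" using p_id \<phi>g by force
    have g: "g \<in> V" "- g \<in> V" using Sd[OF \<phi>g] subspace_minus[OF s V] by auto
    \<comment> \<open>Elements of \<open>S\<close> over the same \<open>g\<close> differ by some
      \<open>(k', 0)\<close>, to which the assumption on \<open>x\<close> applies. This leaves only
      the chosen element \<open>(L g, g)\<close>, controlled by
      \<open>\<gamma> (- g)\<close>.\<close>
    define k' where "k' = \<phi> - L g"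
    have "(k', 0) \<in> S"
      using subspace_diff[OF VS Ssub \<phi>g LpS[of g]] by (simp add: k'_def pg)
    then have "c (k', 0) * c (L g, g) = e (- L g 0) * c (\<phi>, g)"
      using c(1)[of "(k', 0)" "(L g, g)"] LpS[of g] by (simp add: pg k'_def)
    then have c\<phi>: "c (\<phi>, g) = e (k' x) * c (L g, g)"
      using k[OF \<open>(k', 0) \<in> S\<close>] dual_zero[OF s V Ld] e0 by simp
    have "\<gamma> (- g) = c (L g, g)"
      using dual_zero[OF s V Ld, of g] e0 by (simp add: \<gamma>_def L_minus p_minus pg)
    moreover have "A x (- g) = - L g x"
      using x g by (simp add: A_def L_minus dual_minus[OF s V Ld] Lp[of g x] pg)
    ultimately have "\<gamma> (x - g) = \<gamma> x * c (L g, g) * inverse (e (L g x))"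
      using \<gamma>_add[OF x g(2)] e0(3) by simp
    moreover have "e (\<phi> x) = e (k' x) * e (L g x)"
      by (simp add: k'_def flip: e(1))
    ultimately show ?thesis
      using e0(2) c\<phi> by simp
  qed
  have "\<gamma> 0 = 1"
    using c(2) e0 by (simp add: \<gamma>_def L0 p0 flip: zero_prod_def)
  then show thesis
    using that A_lin A_sym \<gamma>_add S_shift by blast
qed

section \<open>The block operator on the direct sum\<close>

lemma sum3_scale_eq:
  assumes "vector_space sH" "vector_space sF" "vector_space sG"
  shows "sum3_scale sH sF sG = (\<lambda>c (h, f, g). (sH c h, sF c f, sG c g))"
proof -
  have "module sH" "module sF" "module sG"
    using assms by (simp_all add: module_iff_vector_space)
  moreover have "module (module_prod.scale sF sG)"
    using vector_space_prod_scale[OF assms(2,3)] by (simp add: module_iff_vector_space)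
  ultimately show ?thesis
    by (auto simp: sum3_scale_def prod_scale fun_eq_iff)
qed

lemma vector_space_sum3_scale:
  assumes "vector_space sH" "vector_space sF" "vector_space sG"
  shows "vector_space (sum3_scale sH sF sG)"
  using assms by (simp add: sum3_scale_def vector_space_prod_scale)

lemma subspace_sum3:
  assumes "vector_space sH" "vector_space sF" "vector_space sG"
    and "module.subspace sH H" "module.subspace sF F" "module.subspace sG G"
  shows "module.subspace (sum3_scale sH sF sG) (H \<times> F \<times> G)"
  using assms(4-6) unfolding module_subspace_iff[OF vector_space_sum3_scale[OF assms(1-3)]]
    module_subspace_iff[OF assms(1)] module_subspace_iff[OF assms(2)] module_subspace_iff[OF assms(3)]
  by (auto simp: sum3_scale_eq[OF assms(1-3)] zero_prod_def)

lemma graph_operator_apply: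
  assumes "h \<in> H" "f \<in> F" "g \<in> G" "h' \<in> H" "f' \<in> F" "g' \<in> G"
  shows "graph_operator H F G A B C (h, f, g) (h', f', g') =
    B h' g + C f' g + (B h g' + C f g' + A g g')"
  using assms by (simp add: graph_operator_def dual_sum3_def adjoint_on_def)

lemma graph_operator_outside:
  "w \<notin> H \<times> F \<times> G \<Longrightarrow> graph_operator H F G A B C v w = 0"
  by (cases v; cases w) (auto simp: graph_operator_def dual_sum3_def)

text \<open>Exchanging the two arguments swaps \<open>B\<close> and \<open>C\<close> with their
  adjoint blocks, so symmetry reduces to that of \<open>A\<close>.\<close>

lemma symmetric_graph_operator:
  assumes s: "vector_space sH" "vector_space sF" "vector_space sG"
    and sub: "module.subspace sH H" "module.subspace sF F" "module.subspace sG G"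
    and A: "linear_on sG fun_scale G (dual sG G) A"
    and B: "linear_on sH fun_scale H (dual sG G) B"
    and C: "linear_on sF fun_scale F (dual sG G) C"
    and sym: "\<And>x y. x \<in> G \<Longrightarrow> y \<in> G \<Longrightarrow> A x y = A y x"
  shows "symmetric_operator (sum3_scale sH sF sG) (H \<times> F \<times> G) (graph_operator H F G A B C)"
proof -
  let ?V = "H \<times> F \<times> G" and ?\<Gamma> = "graph_operator H F G A B C"
  have Bd: "B h \<in> dual sG G" "B (h + h') = B h + B h'" "B (sH k h) = fun_scale k (B h)"
    if "h \<in> H" "h' \<in> H" for h h' k
    using B that by (auto simp: linear_on_def)
  have Cd: "C h \<in> dual sG G" "C (h + h') = C h + C h'" "C (sF k h) = fun_scale k (C h)"
    if "h \<in> F" "h' \<in> F" for h h' k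
    using C that by (auto simp: linear_on_def)
  have Ad: "A h \<in> dual sG G" "A (h + h') = A h + A h'" "A (sG k h) = fun_scale k (A h)"
    if "h \<in> G" "h' \<in> G" for h h' k
    using A that by (auto simp: linear_on_def)
  have H: "h + h' \<in> H" "sH k h \<in> H" if "h \<in> H" "h' \<in> H" for h h' k
    using sub(1) that by (auto simp: module_subspace_iff[OF s(1)])
  have F: "h + h' \<in> F" "sF k h \<in> F" if "h \<in> F" "h' \<in> F" for h h' k
    using sub(2) that by (auto simp: module_subspace_iff[OF s(2)])
  have G: "h + h' \<in> G" "sG k h \<in> G" if "h \<in> G" "h' \<in> G" for h h' k
    using sub(3) that by (auto simp: module_subspace_iff[OF s(3)])
  have "?\<Gamma> v \<in> dual (sum3_scale sH sF sG) ?V" if "v \<in> ?V" for v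
    using that unfolding dual_def linear_on_def
    by (auto simp: graph_operator_apply graph_operator_outside sum3_scale_eq[OF s] H F G Bd Cd
        dual_add[OF Ad(1)] dual_add[OF Bd(1)] dual_add[OF Cd(1)] dual_scale[OF Ad(1)]
        dual_scale[OF Bd(1)] dual_scale[OF Cd(1)] fun_scale_def algebra_simps)
  moreover have "?\<Gamma> (v + v') = ?\<Gamma> v + ?\<Gamma> v'" if "v \<in> ?V" "v' \<in> ?V" for v v'
  proof
    fix w show "?\<Gamma> (v + v') w = (?\<Gamma> v + ?\<Gamma> v') w"
      using that by (cases "w \<in> ?V")
        (auto simp: graph_operator_apply graph_operator_outside H F G Ad Bd Cd dual_add[OF Bd(1)]
          dual_add[OF Cd(1)])
  qed
  moreover have "?\<Gamma> (sum3_scale sH sF sG k v) = fun_scale k (?\<Gamma> v)" if "v \<in> ?V" for k v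
  proof
    fix w show "?\<Gamma> (sum3_scale sH sF sG k v) w = fun_scale k (?\<Gamma> v) w"
      using that by (cases "w \<in> ?V")
        (auto simp: graph_operator_apply graph_operator_outside sum3_scale_eq[OF s] H F G Ad Bd Cd
          dual_scale[OF Bd(1)] dual_scale[OF Cd(1)] fun_scale_def algebra_simps)
  qed
  moreover have "adjoint_on ?V ?\<Gamma> v = ?\<Gamma> v" if "v \<in> ?V" for v
    using that by (auto simp: adjoint_on_def fun_eq_iff graph_operator_apply graph_operator_outside sym)
  ultimately show ?thesis
    by (auto simp: symmetric_operator_def linear_on_def)
qed

section \<open>The stabilizer space as the image of a graph code\<close>

theorem theoremV1:
  fixes chi :: "'f::{field,finite} \<Rightarrow> 'f \<Rightarrow> complex"
    and sG :: "'f \<Rightarrow> 'g::ab_group_add \<Rightarrow> 'g"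
    and G :: "'g set"
    and S :: "(('g \<Rightarrow> 'f) \<times> 'g) set"
    and \<zeta> :: "'g L2_op \<Rightarrow> complex"
  assumes "symmetric_self_duality chi"
    and "fin_dim_space sG G"
    and "isotropic sG G S"
    and "algebra_character G (weyl_algebra chi G S) \<zeta>"
  shows "\<exists>(H :: (nat \<Rightarrow> 'f) set) (F :: (nat \<Rightarrow> 'f) set) A B C \<Gamma> \<tau>'.
    fin_dim_space fun_scale H \<and> fin_dim_space fun_scale F \<and>
    linear_on sG fun_scale G (dual sG G) A \<and>
    linear_on fun_scale fun_scale H (dual sG G) B \<and> inj_on B H \<and>
    linear_on fun_scale fun_scale F (dual sG G) C \<and>
    \<Gamma> = graph_operator H F G A B C \<and>
    symmetric_operator (sum3_scale fun_scale fun_scale sG) (H \<times> F \<times> G) \<Gamma> \<and>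
    algebra_character (H \<times> F \<times> G)
      (weyl_algebra chi (H \<times> F \<times> G) (graph_subspace (H \<times> F \<times> G) \<Gamma>)) \<tau>' \<and>
    equivalent_codes chi sG G (stabilizer_code chi G \<zeta> S)
      (graph_code H F G (graph_phase chi (H \<times> F \<times> G) \<Gamma> \<tau>'))"
proof -
  note e = self_duality_one[OF assms(1)]
  note e0 = additive_exponential[of "chi 1", OF e(1,2)]
  have sG: "vector_space sG"
    using assms(2) by (simp add: fin_dim_space_def)
  have G: "module.subspace sG G" "finite G"
    using assms(2) by (simp_all add: fin_dim_space_iff_finite[OF sG])
  have m: "module (fun_scale :: 'f \<Rightarrow> ('g \<Rightarrow> 'f) \<Rightarrow> _)" "module sG"
    using vector_space_fun_scale sG by (simp_all add: module_iff_vector_space)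
  have S: "S \<subseteq> dual sG G \<times> G" "module.subspace (module_prod.scale fun_scale sG) S"
    and iso: "\<And>\<phi> x \<psi> y. (\<phi>, x) \<in> S \<Longrightarrow> (\<psi>, y) \<in> S \<Longrightarrow> \<phi> y = \<psi> x"
    using assms(3) by (auto simp: isotropic_def)
  have S0: "(0, 0) \<in> S" and S_add: "\<And>p q. p \<in> S \<Longrightarrow> q \<in> S \<Longrightarrow> p + q \<in> S"
    and S_scale: "\<And>k \<phi> g. (\<phi>, g) \<in> S \<Longrightarrow> (fun_scale k \<phi>, sG k g) \<in> S"
    using S(2) unfolding module_subspace_iff[OF vector_space_prod_scale[OF vector_space_fun_scale sG]]
    by (auto simp: prod_scale[OF m] zero_prod_def)
  have sG0: "sG k 0 = 0" for k
    using module.scale_zero_right[OF m(2)] .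
  define c where "c p = \<zeta> (weyl chi G p)" for p
  have c_mult: "c p * c q = chi 1 (- fst q (snd p)) * c (p + q)" if "p \<in> S" "q \<in> S" for p q
    unfolding c_def using character_weyl_mult[OF e(1) sG G(1) assms(4) S(1) that S_add[OF that]] .
  have c0: "c 0 = 1"
    using assms(4) weyl_zero[of chi G] e0(1) by (simp add: c_def algebra_character_def)
  obtain A \<gamma> where A: "linear_on sG fun_scale G (dual sG G) A"
      "\<And>x y. x \<in> G \<Longrightarrow> y \<in> G \<Longrightarrow> A x y = A y x"
    and \<gamma>: "\<gamma> 0 = 1" "\<And>x y. x \<in> G \<Longrightarrow> y \<in> G \<Longrightarrow> \<gamma> (x + y) = \<gamma> x * \<gamma> y * chi 1 (A x y)"
    and shift: "\<And>\<phi> g x. (\<phi>, g) \<in> S \<Longrightarrow> x \<in> G \<Longrightarrow> (\<And>k. (k, 0) \<in> S \<Longrightarrow> c (k, 0) = chi 1 (k x)) \<Longrightarrow>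
      chi 1 (\<phi> x) * \<gamma> (x - g) = c (\<phi>, g) * \<gamma> x"
    using symmetric_phase_extension[of sG G S "chi 1" c, OF sG G(1) assms(3) e(1,2) c_mult c0] by blast
  \<comment> \<open>Expanding \<open>\<gamma> (x + - x) = 1\<close> exhibits
    \<open>\<gamma> x\<close> as a factor of 1.\<close>
  have \<gamma>_nz: "\<gamma> x \<noteq> 0" if "x \<in> G" for x
    using \<gamma>(2)[OF that subspace_minus[OF sG G(1) that]] \<gamma>(1) by auto
  define K where "K = {k. (k, 0) \<in> S}"
  define P where "P = snd ` S"
  define W where "W = {\<phi> \<in> dual sG G. \<forall>x\<in>P. \<phi> x = 0}"
  have K: "module.subspace fun_scale K"
    using S0 S_add S_scale[of _ 0] sG0
    by (auto simp: K_def module_subspace_iff[OF vector_space_fun_scale]) (metis add_0)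
  have KS: "K \<subseteq> dual sG G"
    using S by (auto simp: K_def)
  have P: "module.subspace sG P" "P \<subseteq> G"
  proof -
    have "x + y \<in> P" if "x \<in> P" "y \<in> P" for x y
      using that S_add unfolding P_def by (metis (no_types, opaque_lifting) imageE image_eqI snd_add)
    then show "module.subspace sG P"
      using S0 S_scale unfolding P_def module_subspace_iff[OF sG] by (force simp: image_iff)
    show "P \<subseteq> G" using S by (auto simp: P_def)
  qed
  have W: "module.subspace fun_scale W"
    using subspace_dual[OF sG, of G]
    by (auto simp: W_def module_subspace_iff[OF vector_space_fun_scale] fun_scale_def)
  obtain H :: "(nat \<Rightarrow> 'f) set" and B where H: "fin_dim_space fun_scale H"
    and B: "linear_on fun_scale fun_scale H W B" "bij_betw B H W"
  proof (rule coordinate_space[OF G(2) W])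
    show "\<phi> x = 0" if "\<phi> \<in> W" "x \<notin> G" for \<phi> x
      using that by (auto simp: W_def dual_outside)
  qed
  obtain F :: "(nat \<Rightarrow> 'f) set" and C where F: "fin_dim_space fun_scale F"
    and C: "linear_on fun_scale fun_scale F K C" "bij_betw C F K"
    using coordinate_space[OF G(2) K] KS dual_outside by blast
  have B': "linear_on fun_scale fun_scale H (dual sG G) B"
    using B(1) by (auto simp: linear_on_def W_def)
  have C': "linear_on fun_scale fun_scale F (dual sG G) C"
    using C(1) KS by (auto simp: linear_on_def)
  have Hs: "module.subspace fun_scale H" "finite H" and Fs: "module.subspace fun_scale F" "finite F"
    using H F by (simp_all add: fin_dim_space_iff_finite[OF vector_space_fun_scale])
  have Bd: "B h \<in> dual sG G" "B (h + h') = B h + B h'" if "h \<in> H" "h' \<in> H" for h h'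
    using B' that by (auto simp: linear_on_def)
  have Cd: "C f \<in> dual sG G" "C (f + f') = C f + C f'" "C f \<in> K" if "f \<in> F" "f' \<in> F" for f f'
    using C C' that by (auto simp: linear_on_def)
  have H0: "0 \<in> H" and F0: "0 \<in> F"
    using Hs Fs by (simp_all add: module_subspace_iff[OF vector_space_fun_scale])
  have B0: "B 0 = 0" and C0: "C 0 = 0"
    using Bd(2)[OF H0 H0] Cd(2)[OF F0 F0] by simp_all
  have F_add: "f + f' \<in> F" "- f \<in> F" if "f \<in> F" "f' \<in> F" for f f'
    using Fs that subspace_minus[OF vector_space_fun_scale Fs(1)]
    by (auto simp: module_subspace_iff[OF vector_space_fun_scale])
  have K_minus: "- k \<in> K" if "k \<in> K" for k
    using subspace_minus[OF vector_space_fun_scale K that] .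
  have cK_add: "c (k + k', 0) = c (k, 0) * c (k', 0)" if "k \<in> K" "k' \<in> K" for k k'
    using c_mult[of "(k, 0)" "(k', 0)"] that dual_zero[OF sG G(1), of k'] KS e0(1)
    by (auto simp: K_def)
  have cK0: "c (0, 0) = 1"
    using c0 by (simp add: zero_prod_def)
  let ?V = "H \<times> F \<times> G" and ?\<Gamma> = "graph_operator H F G A B C"
  note sV = vector_space_sum3_scale[OF vector_space_fun_scale vector_space_fun_scale sG]
  have V: "module.subspace (sum3_scale fun_scale fun_scale sG) ?V"
    using subspace_sum3[OF vector_space_fun_scale vector_space_fun_scale sG Hs(1) Fs(1) G(1)] .
  have sym: "symmetric_operator (sum3_scale fun_scale fun_scale sG) ?V ?\<Gamma>"
    using symmetric_graph_operator[OF vector_space_fun_scale vector_space_fun_scale sG Hs(1) Fs(1)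
        G(1) A(1) B' C' A(2)] .
  \<comment> \<open>The pairings with \<open>B\<close> and \<open>C\<close> polarize to the
    off-diagonal blocks of the operator and \<open>\<gamma>\<close> to \<open>A\<close>. The factor
    \<open>c (- C f, 0)\<close> is multiplicative in \<open>f\<close>, so it adds nothing to the
    polarization.\<close>
  define t where "t = (\<lambda>(h, f, g). c (- C f, 0) * chi 1 (B h g) * chi 1 (C f g) * \<gamma> g)"
  have "t 0 = 1"
    using \<gamma>(1) cK0 e0(1) by (simp add: t_def zero_prod_def B0 C0)
  moreover have "t (v + w) = t v * t w * chi 1 (?\<Gamma> v w)" if "v \<in> ?V" "w \<in> ?V" for v w
  proof -
    obtain h f g h' f' g' where vw: "v = (h, f, g)" "w = (h', f', g')"
      by (cases v; cases w)
    then have vw_in: "h \<in> H" "f \<in> F" "g \<in> G" "h' \<in> H" "f' \<in> F" "g' \<in> G"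
      using that by auto
    have "c (- C f - C f', 0) = c (- C f, 0) * c (- C f', 0)"
      using cK_add[OF K_minus K_minus, of "C f" "C f'"] Cd(3) vw_in by simp
    moreover have "B k (g + g') = B k g + B k g'" if "k \<in> H" for k
      using dual_add[OF Bd(1)] that vw_in by blast
    moreover have "C k (g + g') = C k g + C k g'" if "k \<in> F" for k
      using dual_add[OF Cd(1)] that vw_in by blast
    ultimately show ?thesis
      using vw_in by (simp add: vw t_def Bd(2) Cd(2) \<gamma>(2) graph_operator_apply e(1) mult_ac)
  qed
  moreover have "?\<Gamma> v \<in> dual (sum3_scale fun_scale fun_scale sG) ?V" if "v \<in> ?V" for v
    using sym that unfolding symmetric_operator_def linear_on_def by blast
  ultimately obtain \<tau>' where \<tau>':
    "algebra_character ?V (weyl_algebra chi ?V (graph_subspace ?V ?\<Gamma>)) \<tau>'"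
    "\<And>v. v \<in> ?V \<Longrightarrow> graph_phase chi ?V ?\<Gamma> \<tau>' v = t v"
    using graph_phase_of_quadratic[where chi = chi and t = t and \<Gamma> = ?\<Gamma>, OF e(1,2) sV V]
    by blast
  define D where "D = {x \<in> G. \<forall>k\<in>K. c (k, 0) = chi 1 (k x)}"
  \<comment> \<open>The \<open>card F\<close> from the character sum cancels the normalization of
    the integral over \<open>F\<close>; only the division by \<open>card H\<close> is left.\<close>
  define q where "q = complex_of_real (sqrt (real (card H) * real (card F))) / of_nat (card H)"
  have q: "q \<noteq> 0"
    using Hs(2) Fs(2) H0 F0 by (auto simp: q_def)
  \<comment> \<open>The summand is a character of \<open>F\<close>, and since
    \<open>c (- k, 0)\<close> inverts \<open>c (k, 0)\<close>, it is trivial exactly when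
    \<open>x\<close> satisfies the conditions defining \<open>D\<close>.\<close>
  have F_sum: "(\<Sum>f\<in>F. c (- C f, 0) * chi 1 (C f x)) = (if x \<in> D then of_nat (card F) else 0)"
    if x: "x \<in> G" for x
  proof -
    have inv: "c (- k, 0) * c (k, 0) = 1" if "k \<in> K" for k
      using cK_add[OF K_minus[OF that] that] cK0 by simp
    have "(\<Sum>f\<in>F. c (- C f, 0) * chi 1 (C f x)) =
        (if \<forall>f\<in>F. c (- C f, 0) * chi 1 (C f x) = 1 then of_nat (card F) else 0)"
    proof (rule character_sum)
      fix f f' assume f: "f \<in> F" "f' \<in> F"
      then show "c (- C (f + f'), 0) * chi 1 (C (f + f') x) =
          c (- C f, 0) * chi 1 (C f x) * (c (- C f', 0) * chi 1 (C f' x))"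
        using cK_add[OF K_minus K_minus, of "C f" "C f'"] Cd by (simp add: e(1))
    qed (use F_add in auto)
    also have "(\<forall>f\<in>F. c (- C f, 0) * chi 1 (C f x) = 1) \<longleftrightarrow> (\<forall>k\<in>K. c (- k, 0) * chi 1 (k x) = 1)"
      using C(2) unfolding bij_betw_def by blast
    also have "\<dots> \<longleftrightarrow> x \<in> D"
    proof -
      have "c (- k, 0) * chi 1 (k x) = 1 \<longleftrightarrow> c (k, 0) = chi 1 (k x)" if "k \<in> K" for k
        using inv[OF that] by (metis mult_cancel_left mult_zero_left zero_neq_one)
      then show ?thesis using x by (auto simp: D_def)
    qed
    finally show ?thesis .
  qed
  have code: "snd (graph_code H F G (graph_phase chi ?V ?\<Gamma> \<tau>')) \<psi> x =
      (if x \<in> D then q * \<gamma> x * (\<Sum>h\<in>H. chi 1 (B h x) * \<psi> h) else 0)" for \<psi> x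
  proof (cases "x \<in> G")
    case True
    have "haar_integral F (\<lambda>f. graph_phase chi ?V ?\<Gamma> \<tau>' (h, f, x) * \<psi> h) =
        (if x \<in> D then chi 1 (B h x) * \<gamma> x * \<psi> h else 0)" if "h \<in> H" for h
    proof -
      have "(\<Sum>f\<in>F. graph_phase chi ?V ?\<Gamma> \<tau>' (h, f, x) * \<psi> h) =
          (\<Sum>f\<in>F. chi 1 (B h x) * \<gamma> x * \<psi> h * (c (- C f, 0) * chi 1 (C f x)))"
        using that True by (intro sum.cong) (auto simp: \<tau>'(2) t_def)
      also have "\<dots> = chi 1 (B h x) * \<gamma> x * \<psi> h * (if x \<in> D then of_nat (card F) else 0)"
        by (simp only: F_sum[OF True] flip: sum_distrib_left)
      finally show ?thesis
        using Fs(2) F0 by (auto simp: haar_integral_def)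
    qed
    then have "haar_integral H (\<lambda>h. haar_integral F (\<lambda>f. graph_phase chi ?V ?\<Gamma> \<tau>' (h, f, x) * \<psi> h)) =
        (\<Sum>h\<in>H. if x \<in> D then chi 1 (B h x) * \<gamma> x * \<psi> h else 0) / of_nat (card H)"
      by (simp add: haar_integral_def[of H])
    then show ?thesis
      using True by (simp add: graph_code_def q_def sum_distrib_left mult_ac)
  qed (auto simp: graph_code_def D_def)
  \<comment> \<open>Both sides of each eigenvalue equation vanish outside \<open>G\<close>, so it
    may be tested at the points of \<open>G\<close>.\<close>
  have stab: "\<psi> \<in> stabilizer_space chi G \<zeta> S \<longleftrightarrow>
      \<psi> \<in> L2 G \<and> (\<forall>\<phi> g x. (\<phi>, g) \<in> S \<longrightarrow> x \<in> G \<longrightarrow> chi 1 (\<phi> x) * \<psi> (x - g) = c (\<phi>, g) * \<psi> x)" for \<psi>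
  proof -
    have "weyl chi G (\<phi>, g) \<psi> = (\<lambda>x. z * \<psi> x) \<longleftrightarrow> (\<forall>x\<in>G. chi 1 (\<phi> x) * \<psi> (x - g) = z * \<psi> x)"
      if "\<psi> \<in> L2 G" for \<phi> g z
      using that by (auto simp: weyl_def fun_eq_iff L2_def)
    then show ?thesis
      unfolding stabilizer_space_iff[OF assms(4)] c_def[symmetric] by (auto split: prod.splits)
  qed
  \<comment> \<open>Isotropy of \<open>(k, 0)\<close> against \<open>(\<phi>, g)\<close> gives
    \<open>k g = \<phi> 0 = 0\<close>, so every \<open>k\<close> in \<open>K\<close> is constant
    along \<open>P\<close>.\<close>
  have D_shift: "x - g \<in> D \<longleftrightarrow> x \<in> D" if "x \<in> G" "g \<in> P" for x g
  proof -
    obtain \<phi> where \<phi>: "(\<phi>, g) \<in> S" using \<open>g \<in> P\<close> by (auto simp: P_def)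
    have "k (x - g) = k x" if "k \<in> K" for k
    proof -
      have "k \<in> dual sG G" "g \<in> G" using that KS P(2) \<open>g \<in> P\<close> by auto
      moreover have "k g = 0"
        using iso[of k 0 \<phi> g] that \<phi> dual_zero[OF sG G(1), of \<phi>] S(1) by (auto simp: K_def)
      ultimately show ?thesis
        using dual_diff[OF sG G(1), of k x g] \<open>x \<in> G\<close> by simp
    qed
    moreover have "x - g \<in> G"
      using subspace_diff[OF sG G(1)] that P(2) by blast
    ultimately show ?thesis
      using that(1) unfolding D_def mem_Collect_eq by metis
  qed
  have D_eq: "chi 1 (\<phi> x) * \<gamma> (x - g) = c (\<phi>, g) * \<gamma> x" if "(\<phi>, g) \<in> S" "x \<in> D" for \<phi> g x
    using shift[OF that(1)] that(2) by (auto simp: D_def K_def)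
  have "stabilizer_space chi G \<zeta> S =
      snd (graph_code H F G (graph_phase chi ?V ?\<Gamma> \<tau>')) ` L2 H" (is "?L = ?c ` _")
  proof (intro set_eqI iffI)
    fix \<omega> assume "\<omega> \<in> ?c ` L2 H"
    then obtain \<psi> where \<omega>: "\<omega> = ?c \<psi>" by blast
    \<comment> \<open>Functionals \<open>B h\<close> vanish on \<open>P\<close>, so the sum over
      \<open>H\<close> is invariant under the shift; \<open>\<gamma>\<close> alone produces the
      eigenvalue on \<open>D\<close>, and off \<open>D\<close> both sides are zero.\<close>
    have "chi 1 (\<phi> x) * \<omega> (x - g) = c (\<phi>, g) * \<omega> x" if "(\<phi>, g) \<in> S" "x \<in> G" for \<phi> g x
    proof (cases "x \<in> D")
      case True
      have "g \<in> P" using that(1) by (force simp: P_def)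
      have "B h (x - g) = B h x" if "h \<in> H" for h
      proof -
        have "B h \<in> W" using B(1) that by (auto simp: linear_on_def)
        then have "B h g = 0" using \<open>g \<in> P\<close> by (simp add: W_def)
        moreover have "g \<in> G" using P(2) \<open>g \<in> P\<close> by blast
        ultimately show ?thesis
          using dual_diff[OF sG G(1) Bd(1)[OF that that], of x g] \<open>x \<in> G\<close> by simp
      qed
      then have "(\<Sum>h\<in>H. chi 1 (B h (x - g)) * \<psi> h) = (\<Sum>h\<in>H. chi 1 (B h x) * \<psi> h)"
        by simp
      then show ?thesis
        using D_eq[OF that(1) True] True D_shift[OF that(2) \<open>g \<in> P\<close>] by (simp add: \<omega> code)
    next
      case False
      have "g \<in> P" using that(1) by (force simp: P_def)
      then show ?thesis
        using False D_shift[OF that(2) \<open>g \<in> P\<close>] by (simp add: \<omega> code)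
    qed
    moreover have "\<omega> \<in> L2 G"
      by (auto simp: L2_def \<omega> code D_def)
    ultimately show "\<omega> \<in> ?L"
      by (simp add: stab)
  next
    fix \<omega> assume "\<omega> \<in> ?L"
    then have \<omega>: "\<omega> \<in> L2 G"
      "\<And>\<phi> g x. (\<phi>, g) \<in> S \<Longrightarrow> x \<in> G \<Longrightarrow> chi 1 (\<phi> x) * \<omega> (x - g) = c (\<phi>, g) * \<omega> x"
      by (auto simp: stab)
    \<comment> \<open>For \<open>g = 0\<close> the eigenvalue equation is a multiplication by
      \<open>chi 1 (k x)\<close>; where \<open>\<omega> x\<close> is nonzero it can be
      cancelled.\<close>
    have supp: "x \<in> D" if "\<omega> x \<noteq> 0" for x
    proof -
      have "x \<in> G" using that \<omega>(1) by (auto simp: L2_def)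
      then show ?thesis
        using \<omega>(2)[of _ 0 x] that by (auto simp: D_def K_def)
    qed
    \<comment> \<open>On \<open>D\<close> both \<open>\<omega>\<close> and \<open>\<gamma>\<close>
      obey the same shift equations, so their quotient is invariant under \<open>P\<close>.
      Extension by zero keeps this because \<open>D\<close> is invariant too.\<close>
    define u where "u x = (if x \<in> D then \<omega> x / (q * \<gamma> x) else 0)" for x
    have u: "u (x - y) = u x" if x: "x \<in> G" and y: "y \<in> P" for x y
    proof (cases "x \<in> D")
      case True
      obtain \<phi> where \<phi>: "(\<phi>, y) \<in> S" using y by (auto simp: P_def)
      have "x - y \<in> G" using subspace_diff[OF sG G(1)] x y P(2) by blast
      then have nz: "\<gamma> x \<noteq> 0" "\<gamma> (x - y) \<noteq> 0" "chi 1 (\<phi> x) \<noteq> 0"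
        using \<gamma>_nz x e0(2) by auto
      with D_eq[OF \<phi> True] have "c (\<phi>, y) \<noteq> 0"
        by (metis mult_eq_0_iff)
      \<comment> \<open>The two shift equations are multiplied crosswise, and the common nonzero
        factors \<open>chi 1 (\<phi> x)\<close> and \<open>c (\<phi>, y)\<close> are
        cancelled.\<close>
      have "\<omega> (x - y) * \<gamma> x = \<omega> x * \<gamma> (x - y)"
      proof -
        have "chi 1 (\<phi> x) * c (\<phi>, y) * (\<omega> (x - y) * \<gamma> x) =
            (chi 1 (\<phi> x) * \<omega> (x - y)) * (c (\<phi>, y) * \<gamma> x)"
          by (simp add: mult_ac)
        also have "\<dots> = (c (\<phi>, y) * \<omega> x) * (chi 1 (\<phi> x) * \<gamma> (x - y))"
          using \<omega>(2)[OF \<phi> x] D_eq[OF \<phi> True] by simp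
        finally show ?thesis
          using nz \<open>c (\<phi>, y) \<noteq> 0\<close> by simp
      qed
      then show ?thesis
        using True D_shift[OF x y] nz q by (simp add: u_def field_simps)
    qed (use D_shift[OF x y] in \<open>simp add: u_def\<close>)
    have "H \<noteq> {}" using H0 by blast
    obtain \<psi> where \<psi>: "\<And>h. h \<notin> H \<Longrightarrow> \<psi> h = 0"
      "\<And>x. x \<in> G \<Longrightarrow> (\<Sum>h\<in>H. chi 1 (B h x) * \<psi> h) = u x"
      using Fourier_expansion_invariant[where e = "chi 1" and u = u, OF sG G P e
          B(2)[unfolded W_def] Hs(2) \<open>H \<noteq> {}\<close> u] by blast
    have "\<omega> x = ?c \<psi> x" for x
    proof (cases "x \<in> D")
      case True
      then have "x \<in> G" by (simp add: D_def)
      then show ?thesis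
        using True \<psi>(2)[of x] \<gamma>_nz[of x] q by (simp add: code u_def)
    next
      case False
      then show ?thesis using supp by (auto simp: code)
    qed
    moreover have "\<psi> \<in> L2 H" using \<psi>(1) by (simp add: L2_def)
    ultimately show "\<omega> \<in> ?c ` L2 H" by blast
  qed
  moreover have "weyl chi G 0 ` ?L = ?L"
  proof -
    have "weyl chi G 0 \<psi> = \<psi>" if "\<psi> \<in> ?L" for \<psi>
      using that weyl_zero[of chi G] e0(1) by (auto simp: stabilizer_space_def L2_id_def L2_def fun_eq_iff)
    then show ?thesis by simp
  qed
  moreover have "0 \<in> dual sG G \<times> G"
    using subspace_dual[OF sG, of G] G(1)
    by (auto simp: zero_prod_def module_subspace_iff[OF sG] module_subspace_iff[OF vector_space_fun_scale])
  ultimately have "equivalent_codes chi sG G (stabilizer_code chi G \<zeta> S)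
      (graph_code H F G (graph_phase chi ?V ?\<Gamma> \<tau>'))"
    unfolding equivalent_codes_def
    by (intro bexI[of _ 0]) (simp_all add: protected_subspace_def stabilizer_code_def graph_code_def)
  then show ?thesis
    using H F A(1) B' B(2) C' sym \<tau>'(1) unfolding bij_betw_def by blast
qed

end
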